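(* Let $G$ be a locally compact group, let $T$ be an abelian locally compact topological group, and let $\alpha : G\times G\to T$ be a normalized 2-cocycle, with associated central extension $\widetilde G = G\times_\alpha T$. Let $K$ be a maximal compact subgroup of $G$ that splits in $\widetilde G$, the cocycle $\alpha$ being chosen in its cohomology class in $H^2(G,T)$ so that $\alpha|_{K\times K}=1$. Let $X = G/K$, let $\theta : X\to G$ be a cross-section (a map with $\theta(x)K = x$ for all $x\in X$), and let $\sigma(g,x) = \theta(gx)^{-1} g\,\theta(x)\in K$ for $g\in G$, $x\in X$. Define \[ \sigma^{(\alpha)}:\widetilde G\times X\to T,\qquad \sigma^{(\alpha)}(\tilde g,x) := \alpha\bigl(g\theta(x),\,\sigma(g,x)^{-1}\bigr)\,\alpha\bigl(g,\theta(x)\bigr)\,t ,\qquad \tilde g=(g,t). \] Then $\sigma^{(\alpha)}$ is a cocycle on $\widetilde G\times X$, i.e. $\sigma^{(\alpha)}(\tilde g_1, g_2x)\,\sigma^{(\alpha)}(\tilde g_2,x)=\sigma^{(\alpha)}(\tilde g_1\tilde g_2,x)$ for all $\tilde g_i=(g_i,t_i)\in\widetilde G$ and $x\in X$, and it induces an action of $\widetilde G$ on the set $\widetilde X := X\times T$ given by $\tilde g(x,\xi) = (gx,\ \sigma^{(\alpha)}(\tilde g,x)\,\xi)$.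
   Context: A normalized 2-cocycle is a map $\alpha:G\times G\to T$ with $\alpha(g_1g_2,g_3)\alpha(g_1,g_2)=\alpha(g_1,g_2g_3)\alpha(g_2,g_3)$ for all $g_1,g_2,g_3\in G$ and $\alpha(g,1)=\alpha(1,g)=1$ for all $g\in G$ ($T$ is written multiplicatively, with trivial $G$-action). The group $\widetilde G = G\times_\alpha T$ is the set $G\times T$ with multiplication $(g_1,t_1)(g_2,t_2)=(g_1g_2,\alpha(g_1,g_2)t_1t_2)$. A closed subgroup $H\le G$ splits in $\widetilde G$ if there is a map $s:H\to T$ with $\alpha(h_1,h_2)=s(h_1h_2)(s(h_1)s(h_2))^{-1}$ for all $h_1,h_2\in H$. $G$ acts on $X=G/K$ by left translation. The space $\widetilde X$ is also written $X\rtimes_{\sigma^{(\alpha)}}T$; as a set it is $X\times T$. *)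

theory Defs
  imports "HOL-Analysis.Analysis" "HOL-Algebra.Left_Coset" "HOL-Algebra.Group_Action"
begin

text \<open>Locally compact groups are Hausdorff by convention.\<close>

locale locally_compact_group = group G for G (structure) +
  fixes \<T> :: "'a topology"
  assumes topspace_eq: "topspace \<T> = carrier G"
    and continuous_mult: "continuous_map (prod_topology \<T> \<T>) \<T> (\<lambda>(x, y). x \<otimes> y)"
    and continuous_inv: "continuous_map \<T> \<T> (\<lambda>x. inv x)"
    and hausdorff: "Hausdorff_space \<T>"
    and locally_compact: "locally_compact_space \<T>"

definition maximal_compact_subgroup ::
    "('a, 'm) monoid_scheme \<Rightarrow> 'a topology \<Rightarrow> 'a set \<Rightarrow> bool" where
  "maximal_compact_subgroup G \<T> K \<longleftrightarrow>
     subgroup K G \<and> compactin \<T> K \<and>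
     (\<forall>L. subgroup L G \<and> compactin \<T> L \<and> K \<subseteq> L \<longrightarrow> L = K)"

definition normalized_cocycle ::
    "('g, 'm) monoid_scheme \<Rightarrow> ('t, 'n) monoid_scheme \<Rightarrow> ('g \<Rightarrow> 'g \<Rightarrow> 't) \<Rightarrow> bool" where
  "normalized_cocycle G T \<alpha> \<longleftrightarrow>
     (\<forall>g1\<in>carrier G. \<forall>g2\<in>carrier G. \<alpha> g1 g2 \<in> carrier T) \<and>
     (\<forall>g1\<in>carrier G. \<forall>g2\<in>carrier G. \<forall>g3\<in>carrier G.
        \<alpha> (g1 \<otimes>\<^bsub>G\<^esub> g2) g3 \<otimes>\<^bsub>T\<^esub> \<alpha> g1 g2 = \<alpha> g1 (g2 \<otimes>\<^bsub>G\<^esub> g3) \<otimes>\<^bsub>T\<^esub> \<alpha> g2 g3) \<and>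
     (\<forall>g\<in>carrier G. \<alpha> g \<one>\<^bsub>G\<^esub> = \<one>\<^bsub>T\<^esub> \<and> \<alpha> \<one>\<^bsub>G\<^esub> g = \<one>\<^bsub>T\<^esub>)"

text \<open>Only the underlying abstract group of the central extension is needed. That
  \<open>(\<one>, \<one>)\<close> is a neutral element relies on \<open>\<alpha>\<close> being normalized.\<close>

definition central_ext ::
    "('g, 'm) monoid_scheme \<Rightarrow> ('t, 'n) monoid_scheme \<Rightarrow> ('g \<Rightarrow> 'g \<Rightarrow> 't) \<Rightarrow> ('g \<times> 't) monoid" where
  "central_ext G T \<alpha> =
     \<lparr>carrier = carrier G \<times> carrier T,
      mult = (\<lambda>(g1, t1) (g2, t2). (g1 \<otimes>\<^bsub>G\<^esub> g2, \<alpha> g1 g2 \<otimes>\<^bsub>T\<^esub> t1 \<otimes>\<^bsub>T\<^esub> t2)),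
      one = (\<one>\<^bsub>G\<^esub>, \<one>\<^bsub>T\<^esub>)\<rparr>"

definition splits_in_ext ::
    "('g, 'm) monoid_scheme \<Rightarrow> 'g topology \<Rightarrow> ('t, 'n) monoid_scheme \<Rightarrow> ('g \<Rightarrow> 'g \<Rightarrow> 't) \<Rightarrow> 'g set \<Rightarrow> bool" where
  "splits_in_ext G \<T> T \<alpha> H \<longleftrightarrow>
     subgroup H G \<and> closedin \<T> H \<and>
     (\<exists>s. s \<in> H \<rightarrow> carrier T \<and>
       (\<forall>h1\<in>H. \<forall>h2\<in>H. \<alpha> h1 h2 = s (h1 \<otimes>\<^bsub>G\<^esub> h2) \<otimes>\<^bsub>T\<^esub> inv\<^bsub>T\<^esub> (s h1 \<otimes>\<^bsub>T\<^esub> s h2)))"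

definition cross_section ::
    "('g, 'm) monoid_scheme \<Rightarrow> 'g set \<Rightarrow> ('g set \<Rightarrow> 'g) \<Rightarrow> bool" where
  "cross_section G K \<theta> \<longleftrightarrow>
     (\<forall>x \<in> lcosets\<^bsub>G\<^esub> K. \<theta> x \<in> carrier G \<and> \<theta> x <#\<^bsub>G\<^esub> K = x)"

text \<open>Points \<open>x\<close> of \<open>G/K\<close> are left cosets, so the left translation \<open>g x\<close> is \<open>g <# x\<close>.\<close>

definition section_cocycle ::
    "('g, 'm) monoid_scheme \<Rightarrow> ('g set \<Rightarrow> 'g) \<Rightarrow> 'g \<Rightarrow> 'g set \<Rightarrow> 'g" where
  "section_cocycle G \<theta> g x =
     inv\<^bsub>G\<^esub> (\<theta> (g <#\<^bsub>G\<^esub> x)) \<otimes>\<^bsub>G\<^esub> g \<otimes>\<^bsub>G\<^esub> \<theta> x"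

definition ext_cocycle ::
    "('g, 'm) monoid_scheme \<Rightarrow> ('t, 'n) monoid_scheme \<Rightarrow> ('g \<Rightarrow> 'g \<Rightarrow> 't) \<Rightarrow> ('g set \<Rightarrow> 'g)
      \<Rightarrow> 'g \<times> 't \<Rightarrow> 'g set \<Rightarrow> 't" where
  "ext_cocycle G T \<alpha> \<theta> = (\<lambda>(g, t) x.
     \<alpha> (g \<otimes>\<^bsub>G\<^esub> \<theta> x) (inv\<^bsub>G\<^esub> (section_cocycle G \<theta> g x)) \<otimes>\<^bsub>T\<^esub> \<alpha> g (\<theta> x) \<otimes>\<^bsub>T\<^esub> t)"

end

theory Submission
  imports Defs
begin

text \<open>
  As \<open>\<alpha>\<close> is trivial on \<open>K\<close>, the map \<open>k \<mapsto> (k, \<one>)\<close> embeds \<open>K\<close> into the central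
  extension. There \<open>\<sigma>\<^sup>(\<^sup>\<alpha>\<^sup>)\<close> is the unique solution \<open>s\<close> of
  \<open>(g, t) (\<theta> x, \<one>) = (\<one>, s) (\<theta> (g x), \<one>) (\<sigma>(g, x), \<one>)\<close>.
  Expanding \<open>(g1, t1) (g2, t2) (\<theta> x, \<one>)\<close> in two ways, with \<open>(\<one>, s)\<close> central,
  gives the cocycle identity.
\<close>

text \<open>\<open>group_action\<close> asks for a homomorphism into \<open>BijGroup E\<close>. The
  pointwise laws suffice, because the maps of \<open>g\<close> and of its inverse undo each other on
  \<open>E\<close>. The assumption \<open>ext\<close> is there because members of
  \<open>Bij E\<close> have a fixed value outside \<open>E\<close>.\<close>

lemma group_actionI:
  assumes "group G"
    and ext: "\<And>g. g \<in> carrier G \<Longrightarrow> \<phi> g \<in> extensional E"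
    and closed: "\<And>g x. g \<in> carrier G \<Longrightarrow> x \<in> E \<Longrightarrow> \<phi> g x \<in> E"
    and one: "\<And>x. x \<in> E \<Longrightarrow> \<phi> \<one>\<^bsub>G\<^esub> x = x"
    and mult: "\<And>g h x. g \<in> carrier G \<Longrightarrow> h \<in> carrier G \<Longrightarrow> x \<in> E
      \<Longrightarrow> \<phi> (g \<otimes>\<^bsub>G\<^esub> h) x = \<phi> g (\<phi> h x)"
  shows "group_action G E \<phi>"
proof -
  interpret group G by fact
  have bij: "\<phi> g \<in> Bij E" if g: "g \<in> carrier G" for g
  proof -
    have "\<phi> (inv\<^bsub>G\<^esub> g) (\<phi> g x) = x" "\<phi> g (\<phi> (inv\<^bsub>G\<^esub> g) x) = x" if "x \<in> E" for x
      using that g by (simp_all flip: mult add: one)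
    then have "bij_betw (\<phi> g) E E"
      using g closed by (intro bij_betw_byWitness[where f' = "\<phi> (inv\<^bsub>G\<^esub> g)"]) auto
    with g ext show ?thesis by (simp add: Bij_def)
  qed
  \<comment> \<open>Both sides are extensional on \<open>E\<close>, so it is enough to compare them
    at points of \<open>E\<close>.\<close>
  have "\<phi> (g \<otimes>\<^bsub>G\<^esub> h) = compose E (\<phi> g) (\<phi> h)"
    if "g \<in> carrier G" "h \<in> carrier G" for g h
    using that by (intro extensionalityI[where A = E]) (auto simp: ext mult compose_def)
  then have "\<phi> \<in> hom G (BijGroup E)"
    by (auto simp: hom_def BijGroup_def bij)
  then show ?thesis
    unfolding group_action_def group_hom_def group_hom_axioms_def
    using group_BijGroup is_group by blast
qed

section \<open>The central extension as a group\<close>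

locale central_extension = G: group G + T: comm_group T
  for G :: "('g, 'm) monoid_scheme" and T :: "('t, 'n) monoid_scheme" +
  fixes \<alpha> :: "'g \<Rightarrow> 'g \<Rightarrow> 't"
  assumes normalized: "normalized_cocycle G T \<alpha>"
begin

abbreviation E where "E \<equiv> central_ext G T \<alpha>"

lemma cocycle_closed [simp, intro]:
  "\<lbrakk>g \<in> carrier G; h \<in> carrier G\<rbrakk> \<Longrightarrow> \<alpha> g h \<in> carrier T"
  using normalized by (simp add: normalized_cocycle_def)

lemma cocycle_one [simp]:
  "g \<in> carrier G \<Longrightarrow> \<alpha> g \<one>\<^bsub>G\<^esub> = \<one>\<^bsub>T\<^esub>"
  "g \<in> carrier G \<Longrightarrow> \<alpha> \<one>\<^bsub>G\<^esub> g = \<one>\<^bsub>T\<^esub>"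
  using normalized by (simp_all add: normalized_cocycle_def)

lemma cocycle_assoc:
  "\<lbrakk>g1 \<in> carrier G; g2 \<in> carrier G; g3 \<in> carrier G\<rbrakk> \<Longrightarrow>
    \<alpha> (g1 \<otimes>\<^bsub>G\<^esub> g2) g3 \<otimes>\<^bsub>T\<^esub> \<alpha> g1 g2 = \<alpha> g1 (g2 \<otimes>\<^bsub>G\<^esub> g3) \<otimes>\<^bsub>T\<^esub> \<alpha> g2 g3"
  using normalized by (simp add: normalized_cocycle_def)

lemma carrier_ext [simp]: "carrier E = carrier G \<times> carrier T"
  and one_ext [simp]: "\<one>\<^bsub>E\<^esub> = (\<one>\<^bsub>G\<^esub>, \<one>\<^bsub>T\<^esub>)"
  and mult_ext [simp]:
    "(g1, t1) \<otimes>\<^bsub>E\<^esub> (g2, t2) = (g1 \<otimes>\<^bsub>G\<^esub> g2, \<alpha> g1 g2 \<otimes>\<^bsub>T\<^esub> t1 \<otimes>\<^bsub>T\<^esub> t2)"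
  by (simp_all add: central_ext_def)

text \<open>Associativity in the second coordinate is the cocycle identity, and normalization makes
  the pair of units neutral. \<open>groupI\<close> needs only left inverses.\<close>

lemma group_ext: "group E"
proof (rule groupI)
  fix x y z assume "x \<in> carrier E" "y \<in> carrier E" "z \<in> carrier E"
  then obtain g1 t1 g2 t2 g3 t3 where
    xyz: "x = (g1, t1)" "y = (g2, t2)" "z = (g3, t3)" and
    c: "g1 \<in> carrier G" "g2 \<in> carrier G" "g3 \<in> carrier G"
       "t1 \<in> carrier T" "t2 \<in> carrier T" "t3 \<in> carrier T"
    by auto
  have "\<alpha> (g1 \<otimes>\<^bsub>G\<^esub> g2) g3 \<otimes>\<^bsub>T\<^esub> (\<alpha> g1 g2 \<otimes>\<^bsub>T\<^esub> t1 \<otimes>\<^bsub>T\<^esub> t2) \<otimes>\<^bsub>T\<^esub> t3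
      = (\<alpha> (g1 \<otimes>\<^bsub>G\<^esub> g2) g3 \<otimes>\<^bsub>T\<^esub> \<alpha> g1 g2) \<otimes>\<^bsub>T\<^esub> (t1 \<otimes>\<^bsub>T\<^esub> t2 \<otimes>\<^bsub>T\<^esub> t3)"
    using c by (simp add: T.m_assoc)
  \<comment> \<open>The cocycle identity is applied before the factors are sorted: sorting first
    could destroy the product on its left-hand side.\<close>
  also have "\<dots> = \<alpha> g1 (g2 \<otimes>\<^bsub>G\<^esub> g3) \<otimes>\<^bsub>T\<^esub> t1 \<otimes>\<^bsub>T\<^esub> (\<alpha> g2 g3 \<otimes>\<^bsub>T\<^esub> t2 \<otimes>\<^bsub>T\<^esub> t3)"
    using c by (simp add: cocycle_assoc, simp add: T.m_ac)
  finally show "x \<otimes>\<^bsub>E\<^esub> y \<otimes>\<^bsub>E\<^esub> z = x \<otimes>\<^bsub>E\<^esub> (y \<otimes>\<^bsub>E\<^esub> z)"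
    using c by (simp add: xyz G.m_assoc)
next
  fix x assume "x \<in> carrier E"
  then obtain g t where x: "x = (g, t)" "g \<in> carrier G" "t \<in> carrier T"
    by auto
  \<comment> \<open>The value solves
    \<open>\<alpha> (inv g) g \<otimes> s \<otimes> t = \<one>\<close>, the second coordinate of the
    equation for a left inverse.\<close>
  define s where "s = inv\<^bsub>T\<^esub> (\<alpha> (inv\<^bsub>G\<^esub> g) g \<otimes>\<^bsub>T\<^esub> t)"
  have s: "s \<in> carrier T"
    using x by (simp add: s_def)
  have "\<alpha> (inv\<^bsub>G\<^esub> g) g \<otimes>\<^bsub>T\<^esub> s \<otimes>\<^bsub>T\<^esub> t = s \<otimes>\<^bsub>T\<^esub> (\<alpha> (inv\<^bsub>G\<^esub> g) g \<otimes>\<^bsub>T\<^esub> t)"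
    using x s by (simp add: T.m_ac)
  also have "\<dots> = \<one>\<^bsub>T\<^esub>"
    using x by (simp add: s_def)
  finally have "(inv\<^bsub>G\<^esub> g, s) \<otimes>\<^bsub>E\<^esub> x = \<one>\<^bsub>E\<^esub>"
    using x by simp
  moreover have "(inv\<^bsub>G\<^esub> g, s) \<in> carrier E"
    using x s by simp
  ultimately show "\<exists>y\<in>carrier E. y \<otimes>\<^bsub>E\<^esub> x = \<one>\<^bsub>E\<^esub>" by blast
qed (auto intro: T.m_closed)

sublocale E: group E by (rule group_ext)

end

section \<open>The section and its two cocycles\<close>

locale split_section = central_extension G T \<alpha>
  for G :: "('g, 'm) monoid_scheme" and T :: "('t, 'n) monoid_scheme"
    and \<alpha> :: "'g \<Rightarrow> 'g \<Rightarrow> 't" +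
  fixes K :: "'g set" and \<theta> :: "'g set \<Rightarrow> 'g"
  assumes subgroup_K: "subgroup K G"
    and trivial_on_subgroup: "\<lbrakk>k1 \<in> K; k2 \<in> K\<rbrakk> \<Longrightarrow> \<alpha> k1 k2 = \<one>\<^bsub>T\<^esub>"
    and is_section: "cross_section G K \<theta>"
begin

abbreviation X where "X \<equiv> lcosets\<^bsub>G\<^esub> K"
abbreviation \<sigma> where "\<sigma> \<equiv> section_cocycle G \<theta>"
abbreviation \<sigma>\<^sub>E where "\<sigma>\<^sub>E \<equiv> ext_cocycle G T \<alpha> \<theta>"

lemma subgroup_carrier: "k \<in> K \<Longrightarrow> k \<in> carrier G"
  by (rule subgroup.mem_carrier[OF subgroup_K])

lemma coset_subset: "x \<in> X \<Longrightarrow> x \<subseteq> carrier G"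
  by (rule subgroup.lcosets_carrier[OF subgroup_K G.is_group])

lemma section_closed: "x \<in> X \<Longrightarrow> \<theta> x \<in> carrier G"
  and section_coset: "x \<in> X \<Longrightarrow> \<theta> x <#\<^bsub>G\<^esub> K = x"
  using is_section by (simp_all add: cross_section_def)

lemma translate_closed: "\<lbrakk>g \<in> carrier G; x \<in> X\<rbrakk> \<Longrightarrow> g <#\<^bsub>G\<^esub> x \<in> X"
  using subgroup.subset[OF subgroup_K] by (force simp: LCOSETS_def G.lcos_m_assoc)

text \<open>Both \<open>g \<otimes> \<theta> x\<close> and \<open>\<theta> (g <# x)\<close>
  represent the coset \<open>g <# x\<close>, so they differ by a right factor from
  \<open>K\<close>.\<close>

lemma section_cocycle_mem:
  assumes g: "g \<in> carrier G" and x: "x \<in> X"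
  shows "\<sigma> g x \<in> K"
proof -
  have "g \<otimes>\<^bsub>G\<^esub> \<theta> x \<in> (g \<otimes>\<^bsub>G\<^esub> \<theta> x) <#\<^bsub>G\<^esub> K"
    using g x by (intro G.lcos_self) (auto simp: section_closed subgroup_K)
  also have "\<dots> = \<theta> (g <#\<^bsub>G\<^esub> x) <#\<^bsub>G\<^esub> K"
    using g x subgroup.subset[OF subgroup_K]
    by (metis G.lcos_m_assoc section_closed section_coset translate_closed)
  finally show ?thesis
    using subgroup.lcos_module_imp[OF subgroup_K G.is_group] g x
    by (simp add: section_cocycle_def G.m_assoc section_closed translate_closed)
qed

lemma section_cocycle_eq:
  assumes g: "g \<in> carrier G" and x: "x \<in> X"
  shows "\<theta> (g <#\<^bsub>G\<^esub> x) \<otimes>\<^bsub>G\<^esub> \<sigma> g x = g \<otimes>\<^bsub>G\<^esub> \<theta> x"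
  using g x by (simp add: section_cocycle_def section_closed translate_closed flip: G.m_assoc)

lemma ext_cocycle_closed:
  assumes "g \<in> carrier G" "t \<in> carrier T" "x \<in> X"
  shows "\<sigma>\<^sub>E (g, t) x \<in> carrier T"
  using assms section_cocycle_mem[of g x]
  by (simp add: ext_cocycle_def section_closed subgroup_carrier)

text \<open>This explains the formula for \<open>\<sigma>\<^sub>E\<close>: the factor
  \<open>\<alpha> g (\<theta> x)\<close> comes from multiplying \<open>(g, t)\<close> by
  \<open>(\<theta> x, \<one>)\<close>, and the other value of \<open>\<alpha>\<close> from then
  dividing by \<open>(\<sigma> g x, \<one>)\<close> on the right.\<close>

lemma ext_cocycle_eq:
  assumes g: "g \<in> carrier G" and t: "t \<in> carrier T" and x: "x \<in> X"
  shows "(g, t) \<otimes>\<^bsub>E\<^esub> (\<theta> x, \<one>\<^bsub>T\<^esub>)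
    = (\<theta> (g <#\<^bsub>G\<^esub> x), \<sigma>\<^sub>E (g, t) x) \<otimes>\<^bsub>E\<^esub> (\<sigma> g x, \<one>\<^bsub>T\<^esub>)"
proof -
  have k: "\<sigma> g x \<in> K" using section_cocycle_mem g x .
  have c: "\<sigma> g x \<in> carrier G" "\<theta> x \<in> carrier G" "\<theta> (g <#\<^bsub>G\<^esub> x) \<in> carrier G"
    using k g x by (simp_all add: subgroup_carrier section_closed translate_closed)
  have e: "(g, t) \<otimes>\<^bsub>E\<^esub> (\<theta> x, \<one>\<^bsub>T\<^esub>) \<in> carrier E"
    using g t c by simp
  have "g \<otimes>\<^bsub>G\<^esub> \<theta> x \<otimes>\<^bsub>G\<^esub> inv\<^bsub>G\<^esub> (\<sigma> g x) = \<theta> (g <#\<^bsub>G\<^esub> x)"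
    using g x c by (simp flip: section_cocycle_eq add: G.m_assoc)
  then have "(g, t) \<otimes>\<^bsub>E\<^esub> (\<theta> x, \<one>\<^bsub>T\<^esub>) \<otimes>\<^bsub>E\<^esub> (inv\<^bsub>G\<^esub> (\<sigma> g x), \<one>\<^bsub>T\<^esub>)
      = (\<theta> (g <#\<^bsub>G\<^esub> x), \<sigma>\<^sub>E (g, t) x)"
    using g t c by (simp add: ext_cocycle_def T.m_assoc)
  \<comment> \<open>Here triviality of \<open>\<alpha>\<close> on \<open>K\<close> enters: it makes
    the inverse of \<open>(\<sigma> g x, \<one>)\<close> have second coordinate
    \<open>\<one>\<close>.\<close>
  moreover have "(inv\<^bsub>G\<^esub> (\<sigma> g x), \<one>\<^bsub>T\<^esub>) \<otimes>\<^bsub>E\<^esub> (\<sigma> g x, \<one>\<^bsub>T\<^esub>) = \<one>\<^bsub>E\<^esub>"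
    using k c by (simp add: trivial_on_subgroup subgroup.m_inv_closed[OF subgroup_K])
  ultimately show ?thesis
    using e c by (metis E.m_assoc E.r_one G.inv_closed T.one_closed carrier_ext mem_Sigma_iff)
qed

text \<open>The product of \<open>(g1, t1)\<close>, \<open>(g2, t2)\<close> and
  \<open>(\<theta> x, \<one>)\<close> is brought into the form
  \<open>(\<theta> z, _) \<otimes> (_, _)\<close> twice, once letting the factors act one after the
  other and once letting their product act. Comparing coordinates gives the identity.\<close>

lemma ext_cocycle_mult:
  assumes g: "g1 \<in> carrier G" "g2 \<in> carrier G" and t: "t1 \<in> carrier T" "t2 \<in> carrier T"
    and x: "x \<in> X"
  shows "\<sigma>\<^sub>E (g1, t1) (g2 <#\<^bsub>G\<^esub> x) \<otimes>\<^bsub>T\<^esub> \<sigma>\<^sub>E (g2, t2) x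
    = \<sigma>\<^sub>E ((g1, t1) \<otimes>\<^bsub>E\<^esub> (g2, t2)) x"
proof -
  define y z k1 k2 k where defs: "y = g2 <#\<^bsub>G\<^esub> x" "z = g1 <#\<^bsub>G\<^esub> y" "k1 = \<sigma> g1 y"
    "k2 = \<sigma> g2 x" "k = \<sigma> (g1 \<otimes>\<^bsub>G\<^esub> g2) x"
  define s1 s2 s where s_defs: "s1 = \<sigma>\<^sub>E (g1, t1) y" "s2 = \<sigma>\<^sub>E (g2, t2) x"
    "s = \<sigma>\<^sub>E ((g1, t1) \<otimes>\<^bsub>E\<^esub> (g2, t2)) x"
  have z: "(g1 \<otimes>\<^bsub>G\<^esub> g2) <#\<^bsub>G\<^esub> x = z"
    using g x coset_subset by (simp add: defs G.lcos_m_assoc)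
  have yz: "y \<in> X" "z \<in> X"
    using g x by (simp_all add: defs translate_closed)
  have kK: "k1 \<in> K" "k2 \<in> K" "k \<in> K"
    using g x yz by (simp_all add: defs section_cocycle_mem translate_closed)
  have c: "k1 \<in> carrier G" "k2 \<in> carrier G" "k \<in> carrier G"
    "\<theta> x \<in> carrier G" "\<theta> y \<in> carrier G" "\<theta> z \<in> carrier G"
    "s1 \<in> carrier T" "s2 \<in> carrier T" "s \<in> carrier T"
    using kK g t x yz
    by (simp_all add: subgroup_carrier section_closed s_defs ext_cocycle_closed)
  have in_E: "(g1, t1) \<in> carrier E" "(\<theta> y, \<one>\<^bsub>T\<^esub>) \<in> carrier E"
    "(\<one>\<^bsub>G\<^esub>, s2) \<in> carrier E" "(k2, \<one>\<^bsub>T\<^esub>) \<in> carrier E"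
    using g t c by simp_all
  have "(g1, t1) \<otimes>\<^bsub>E\<^esub> (g2, t2) \<otimes>\<^bsub>E\<^esub> (\<theta> x, \<one>\<^bsub>T\<^esub>)
      = (g1, t1) \<otimes>\<^bsub>E\<^esub> ((g2, t2) \<otimes>\<^bsub>E\<^esub> (\<theta> x, \<one>\<^bsub>T\<^esub>))"
    using g t c by (intro E.m_assoc) simp_all
  also have "(g2, t2) \<otimes>\<^bsub>E\<^esub> (\<theta> x, \<one>\<^bsub>T\<^esub>) = (\<theta> y, s2) \<otimes>\<^bsub>E\<^esub> (k2, \<one>\<^bsub>T\<^esub>)"
    using g t x by (simp only: ext_cocycle_eq defs s_defs)
  \<comment> \<open>Splitting off the central element \<open>(\<one>, s2)\<close> leaves
    \<open>(\<theta> y, \<one>)\<close> next to \<open>(g1, t1)\<close>, so that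
    \<open>ext_cocycle_eq\<close> applies again, now at \<open>y\<close>.\<close>
  also have "(\<theta> y, s2) = (\<theta> y, \<one>\<^bsub>T\<^esub>) \<otimes>\<^bsub>E\<^esub> (\<one>\<^bsub>G\<^esub>, s2)"
    using c by simp
  also have "(g1, t1) \<otimes>\<^bsub>E\<^esub> ((\<theta> y, \<one>\<^bsub>T\<^esub>) \<otimes>\<^bsub>E\<^esub> (\<one>\<^bsub>G\<^esub>, s2) \<otimes>\<^bsub>E\<^esub> (k2, \<one>\<^bsub>T\<^esub>))
      = ((g1, t1) \<otimes>\<^bsub>E\<^esub> (\<theta> y, \<one>\<^bsub>T\<^esub>)) \<otimes>\<^bsub>E\<^esub> ((\<one>\<^bsub>G\<^esub>, s2) \<otimes>\<^bsub>E\<^esub> (k2, \<one>\<^bsub>T\<^esub>))"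
    using in_E by (simp add: E.m_assoc del: mult_ext carrier_ext)
  also have "(g1, t1) \<otimes>\<^bsub>E\<^esub> (\<theta> y, \<one>\<^bsub>T\<^esub>) = (\<theta> z, s1) \<otimes>\<^bsub>E\<^esub> (k1, \<one>\<^bsub>T\<^esub>)"
    using g t yz by (simp only: ext_cocycle_eq defs s_defs)
  also have "(\<theta> z, s1) \<otimes>\<^bsub>E\<^esub> (k1, \<one>\<^bsub>T\<^esub>) \<otimes>\<^bsub>E\<^esub> ((\<one>\<^bsub>G\<^esub>, s2) \<otimes>\<^bsub>E\<^esub> (k2, \<one>\<^bsub>T\<^esub>))
      = (\<theta> z, s1) \<otimes>\<^bsub>E\<^esub> ((k1, \<one>\<^bsub>T\<^esub>) \<otimes>\<^bsub>E\<^esub> ((\<one>\<^bsub>G\<^esub>, s2) \<otimes>\<^bsub>E\<^esub> (k2, \<one>\<^bsub>T\<^esub>)))"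
    using c by (intro E.m_assoc) simp_all
  \<comment> \<open>No value of \<open>\<alpha>\<close> survives in the right factor:
    \<open>\<alpha> \<one> k2\<close> is trivial by normalization and \<open>\<alpha> k1 k2\<close>
    because both arguments lie in \<open>K\<close>.\<close>
  also have "\<dots> = (\<theta> z, s1) \<otimes>\<^bsub>E\<^esub> (k1 \<otimes>\<^bsub>G\<^esub> k2, s2)"
    using c kK by (simp add: trivial_on_subgroup)
  finally have "(\<theta> z, s1) \<otimes>\<^bsub>E\<^esub> (k1 \<otimes>\<^bsub>G\<^esub> k2, s2)
      = (g1, t1) \<otimes>\<^bsub>E\<^esub> (g2, t2) \<otimes>\<^bsub>E\<^esub> (\<theta> x, \<one>\<^bsub>T\<^esub>)" ..
  \<comment> \<open>The second expansion: \<open>ext_cocycle_eq\<close> for the product element,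
    whose first coordinate also sends \<open>x\<close> to \<open>z\<close>.\<close>
  also have "\<dots> = (\<theta> z, s) \<otimes>\<^bsub>E\<^esub> (k, \<one>\<^bsub>T\<^esub>)"
    using g t x ext_cocycle_eq[of "g1 \<otimes>\<^bsub>G\<^esub> g2" "\<alpha> g1 g2 \<otimes>\<^bsub>T\<^esub> t1 \<otimes>\<^bsub>T\<^esub> t2" x]
    unfolding s_defs defs(5) by (simp only: z mult_ext) simp
  finally have "\<theta> z \<otimes>\<^bsub>G\<^esub> (k1 \<otimes>\<^bsub>G\<^esub> k2) = \<theta> z \<otimes>\<^bsub>G\<^esub> k"
    and eq: "\<alpha> (\<theta> z) (k1 \<otimes>\<^bsub>G\<^esub> k2) \<otimes>\<^bsub>T\<^esub> s1 \<otimes>\<^bsub>T\<^esub> s2 = \<alpha> (\<theta> z) k \<otimes>\<^bsub>T\<^esub> s \<otimes>\<^bsub>T\<^esub> \<one>\<^bsub>T\<^esub>"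
    by simp_all
  \<comment> \<open>Cancelling \<open>\<theta> z\<close> gives the cocycle identity for
    \<open>\<sigma>\<close>. Both second coordinates then contain the same factor
    \<open>\<alpha> (\<theta> z) k\<close>, which cancels in turn.\<close>
  then have "k1 \<otimes>\<^bsub>G\<^esub> k2 = k"
    using c by simp
  with eq have "s1 \<otimes>\<^bsub>T\<^esub> s2 = s"
    using c by (simp add: T.m_assoc)
  then show ?thesis by (simp only: s_defs defs)
qed

text \<open>The unit fixes \<open>x\<close>, so \<open>\<sigma> \<one> x = \<one>\<close>, and both
  values of \<open>\<alpha>\<close> in the formula have an argument \<open>\<one>\<close>.\<close>

lemma ext_cocycle_one:
  assumes x: "x \<in> X"
  shows "\<sigma>\<^sub>E (\<one>\<^bsub>G\<^esub>, \<one>\<^bsub>T\<^esub>) x = \<one>\<^bsub>T\<^esub>"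
  using x coset_subset by (simp add: ext_cocycle_def section_cocycle_def section_closed G.lcos_mult_one)

text \<open>Compatibility with products is associativity of left translation in the first coordinate
  and \<open>ext_cocycle_mult\<close> in the second. The restricted abstraction over
  \<open>(x, \<xi>)\<close> supplies the extensionality that \<open>group_actionI\<close>
  requires.\<close>

lemma ext_action:
  "group_action E (X \<times> carrier T)
    (\<lambda>(g, t). \<lambda>(x, \<xi>) \<in> X \<times> carrier T. (g <#\<^bsub>G\<^esub> x, \<sigma>\<^sub>E (g, t) x \<otimes>\<^bsub>T\<^esub> \<xi>))"
proof (rule group_actionI[OF group_ext], goal_cases)
  \<comment> \<open>This is the law for products; the closing \<open>auto\<close> settles
    extensionality, closure and the unit.\<close>
  case (4 e1 e2 p)
  then obtain g1 t1 g2 t2 x \<xi> where p: "e1 = (g1, t1)" "e2 = (g2, t2)" "p = (x, \<xi>)"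
    and c: "g1 \<in> carrier G" "g2 \<in> carrier G" "t1 \<in> carrier T" "t2 \<in> carrier T"
      "x \<in> X" "\<xi> \<in> carrier T"
    by auto
  have "g1 <#\<^bsub>G\<^esub> (g2 <#\<^bsub>G\<^esub> x) = (g1 \<otimes>\<^bsub>G\<^esub> g2) <#\<^bsub>G\<^esub> x"
    using c coset_subset by (simp add: G.lcos_m_assoc)
  moreover have "\<sigma>\<^sub>E (g1, t1) (g2 <#\<^bsub>G\<^esub> x) \<otimes>\<^bsub>T\<^esub> (\<sigma>\<^sub>E (g2, t2) x \<otimes>\<^bsub>T\<^esub> \<xi>)
      = \<sigma>\<^sub>E (g1 \<otimes>\<^bsub>G\<^esub> g2, \<alpha> g1 g2 \<otimes>\<^bsub>T\<^esub> t1 \<otimes>\<^bsub>T\<^esub> t2) x \<otimes>\<^bsub>T\<^esub> \<xi>"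
    using c ext_cocycle_mult[of g1 g2 t1 t2 x]
    by (simp add: ext_cocycle_closed translate_closed flip: T.m_assoc)
  ultimately show ?case
    using c by (simp add: p ext_cocycle_closed translate_closed)
qed (auto simp: ext_cocycle_closed translate_closed ext_cocycle_one G.lcos_mult_one coset_subset)

end

theorem theorem1p1:
  fixes G :: "('g, 'm) monoid_scheme" and \<T>\<^sub>G :: "'g topology"
    and T :: "('t, 'n) monoid_scheme" and \<T>\<^sub>T :: "'t topology"
    and \<alpha> :: "'g \<Rightarrow> 'g \<Rightarrow> 't" and K :: "'g set" and \<theta> :: "'g set \<Rightarrow> 'g"
  assumes "locally_compact_group G \<T>\<^sub>G"
    and "locally_compact_group T \<T>\<^sub>T" and "comm_group T"
    and "normalized_cocycle G T \<alpha>"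
    and "maximal_compact_subgroup G \<T>\<^sub>G K"
    and "splits_in_ext G \<T>\<^sub>G T \<alpha> K"
    and "\<forall>k1\<in>K. \<forall>k2\<in>K. \<alpha> k1 k2 = \<one>\<^bsub>T\<^esub>"
    and "cross_section G K \<theta>"
  shows "(\<forall>g\<in>carrier G. \<forall>x \<in> lcosets\<^bsub>G\<^esub> K. section_cocycle G \<theta> g x \<in> K)
    \<and> (\<forall>g\<in>carrier (central_ext G T \<alpha>). \<forall>x \<in> lcosets\<^bsub>G\<^esub> K. ext_cocycle G T \<alpha> \<theta> g x \<in> carrier T)
    \<and> (\<forall>g1\<in>carrier G. \<forall>t1\<in>carrier T. \<forall>g2\<in>carrier G. \<forall>t2\<in>carrier T. \<forall>x \<in> lcosets\<^bsub>G\<^esub> K.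
          ext_cocycle G T \<alpha> \<theta> (g1, t1) (g2 <#\<^bsub>G\<^esub> x) \<otimes>\<^bsub>T\<^esub> ext_cocycle G T \<alpha> \<theta> (g2, t2) x
            = ext_cocycle G T \<alpha> \<theta> ((g1, t1) \<otimes>\<^bsub>central_ext G T \<alpha>\<^esub> (g2, t2)) x)
    \<and> group_action (central_ext G T \<alpha>) ((lcosets\<^bsub>G\<^esub> K) \<times> carrier T)
          (\<lambda>(g, t). \<lambda>(x, \<xi>) \<in> (lcosets\<^bsub>G\<^esub> K) \<times> carrier T.
             (g <#\<^bsub>G\<^esub> x, ext_cocycle G T \<alpha> \<theta> (g, t) x \<otimes>\<^bsub>T\<^esub> \<xi>))"
proof -
  interpret central_extension G T \<alpha>
    using assms(1,3,4)
    by (simp add: central_extension_def central_extension_axioms_def locally_compact_group_def)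
  interpret split_section G T \<alpha> K \<theta>
    using assms(5,7,8) central_extension_axioms
    by (simp add: split_section_def split_section_axioms_def maximal_compact_subgroup_def)
  show ?thesis
    using section_cocycle_mem ext_cocycle_closed ext_cocycle_mult ext_action by auto
qed

end
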